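(* Let $\mathcal{T}$ be a compact Hausdorff topology on the set of natural numbers $\mathbb{N}$, and let $C_{\tau}(\mathbb{N})$ be the Banach space of all $\mathcal{T}$-continuous functions $f:\mathbb{N}\to\mathbb{C}$ with the supremum norm. Then the dual Banach space $C_{\tau}(\mathbb{N})^*$ is isometrically isomorphic to $l_1$.
   Context: $\mathbb{N}=\{1,2,3,\dots\}$. $l_1$ is the complex Banach space of absolutely summable complex sequences $a=(a_i)_{i\ge 1}$ with norm $\|a\|_1=\sum_{i=1}^{\infty}|a_i|$. For a compact Hausdorff topology $\mathcal{T}$ on $\mathbb{N}$, $C_{\tau}(\mathbb{N})$ denotes the space of functions $f:\mathbb{N}\to\mathbb{C}$ that are continuous with respect to $\mathcal{T}$ on $\mathbb{N}$ and the usual topology on $\mathbb{C}$, with norm $\|f\|_\infty=\sup_{i\in\mathbb{N}}|f(i)|$. *)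

theory Defs
  imports "HOL-Analysis.Analysis"
begin

text \<open>
  The spaces below depend on a topology given as a term, so they are carrier sets with explicit
  operations rather than types. Spaces of functions on a proper subset of a type contain only
  functions that vanish off that subset; thus equality of elements is equality on the subset, and
  the pointwise operations stay inside the carrier.
\<close>

record 'v complex_normed =
  vcarrier :: "'v set"
  vadd :: "'v \<Rightarrow> 'v \<Rightarrow> 'v"
  vscale :: "complex \<Rightarrow> 'v \<Rightarrow> 'v"
  vnorm :: "'v \<Rightarrow> real"

definition linear_between ::
    "'v complex_normed \<Rightarrow> 'w complex_normed \<Rightarrow> ('v \<Rightarrow> 'w) \<Rightarrow> bool" where
  "linear_between X Y F \<longleftrightarrow>
     (\<forall>x\<in>vcarrier X. F x \<in> vcarrier Y) \<and>
     (\<forall>x\<in>vcarrier X. \<forall>y\<in>vcarrier X. F (vadd X x y) = vadd Y (F x) (F y)) \<and>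
     (\<forall>c. \<forall>x\<in>vcarrier X. F (vscale X c x) = vscale Y c (F x))"

definition scalar_field :: "complex complex_normed" where
  "scalar_field = \<lparr>vcarrier = UNIV, vadd = (+), vscale = (*), vnorm = cmod\<rparr>"

definition dual_space :: "'v complex_normed \<Rightarrow> ('v \<Rightarrow> complex) complex_normed" where
  "dual_space X =
     \<lparr>vcarrier = {\<phi>. linear_between X scalar_field \<phi> \<and>
                     (\<exists>K. \<forall>x\<in>vcarrier X. cmod (\<phi> x) \<le> K * vnorm X x) \<and>
                     (\<forall>x. x \<notin> vcarrier X \<longrightarrow> \<phi> x = 0)},
      vadd = (\<lambda>\<phi> \<psi> x. \<phi> x + \<psi> x),
      vscale = (\<lambda>c \<phi> x. c * \<phi> x),
      vnorm = (\<lambda>\<phi>. SUP x\<in>{x \<in> vcarrier X. vnorm X x \<le> 1}. cmod (\<phi> x))\<rparr>"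

definition isometrically_isomorphic :: "'v complex_normed \<Rightarrow> 'w complex_normed \<Rightarrow> bool" where
  "isometrically_isomorphic X Y \<longleftrightarrow>
     (\<exists>F. linear_between X Y F \<and> bij_betw F (vcarrier X) (vcarrier Y) \<and>
          (\<forall>x\<in>vcarrier X. vnorm Y (F x) = vnorm X x))"

text \<open>
  The supremum in the norm is a genuine one (bounded, over a nonempty set) when the topology is
  compact and its space is nonempty.
\<close>

definition continuous_functions :: "'i topology \<Rightarrow> ('i \<Rightarrow> complex) complex_normed" where
  "continuous_functions T =
     \<lparr>vcarrier = {f. continuous_map T euclidean f \<and> (\<forall>i. i \<notin> topspace T \<longrightarrow> f i = 0)},
      vadd = (\<lambda>f g i. f i + g i),
      vscale = (\<lambda>c f i. c * f i),
      vnorm = (\<lambda>f. SUP i\<in>topspace T. cmod (f i))\<rparr>"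

text \<open>Sequences are indexed from 1; index 0 is the unused point of the index type.\<close>

definition l1 :: "(nat \<Rightarrow> complex) complex_normed" where
  "l1 =
     \<lparr>vcarrier = {a. (\<lambda>i. cmod (a i)) summable_on {1..} \<and> a 0 = 0},
      vadd = (\<lambda>a b i. a i + b i),
      vscale = (\<lambda>c a i. c * a i),
      vnorm = (\<lambda>a. \<Sum>\<^sub>\<infinity>i\<in>{1..}. cmod (a i))\<rparr>"

end

theory Submission imports Defs begin

text \<open>
  The isomorphism sends a bounded functional \<open>\<phi>\<close> to the masses it gives to points: \<open>atom \<phi> i\<close> is the
  limit of \<open>\<phi>\<close> on the indicators of clopen neighbourhoods shrinking to \<open>i\<close>. In terms of measures the
  reason is that a Radon measure on a countable space is purely atomic, but compactness gives a
  direct argument that builds no measure.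

  A continuous real function on a countable space omits values in every interval, so Urysohn
  functions yield clopen separating sets, and compactness turns countably many of them into a
  decreasing clopen neighbourhood base of each point. For a functional \<open>\<phi>\<close>, let \<open>variation \<phi> U\<close>
  be the supremum of \<open>|\<phi> f|\<close> over the functions of norm at most 1 that vanish off \<open>U\<close>; on the whole
  space this is the dual norm. It is additive on disjoint clopen sets, hence monotone, so it
  converges along the base at \<open>i\<close>, and so does \<open>\<phi>\<close> on the indicators. The limit of the variation
  is at most \<open>|atom \<phi> i|\<close> (\<open>variation_nbhd_limit_le_atom\<close>): what a unit function contributes near \<open>i\<close>
  is nearly its value at \<open>i\<close> times the atom.

  Disjoint neighbourhoods of finitely many points give that the sum of the \<open>|atom \<phi> i|\<close> is at most
  the norm (\<open>sum_atoms_le_variation\<close>). Conversely, cover each point by a neighbourhood whose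
  variation exceeds \<open>|atom \<phi> i|\<close> by a term of a summable family with small sum; a finite
  subcover bounds the norm by the sum of all \<open>|atom \<phi> i|\<close> (\<open>variation_le_infsum_atoms\<close>). So
  \<open>atom\<close> is a linear isometry into the summable sequences, and it is onto because the functional
  \<open>f \<mapsto> \<Sum>i. a i * f i\<close> has atoms \<open>a\<close> (\<open>atom_weighted_sum\<close>).
\<close>

section \<open>Two estimates for sums\<close>

lemma sum_half_powers_le:
  assumes "finite F" "inj_on g F"
  shows "(\<Sum>i\<in>F. (1/2::real) ^ Suc (g i)) \<le> 1"
proof -
  have "(\<Sum>i\<in>F. (1/2::real) ^ Suc (g i)) = (\<Sum>k\<in>g ` F. (1/2) ^ Suc k)"
    using assms by (simp add: sum.reindex)
  also have "\<dots> \<le> (\<Sum>k. (1/2) ^ Suc k)"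
    using power_half_series assms by (intro sum_le_suminf) (auto simp: sums_iff)
  also have "\<dots> = 1" using power_half_series by (simp add: sums_iff)
  finally show ?thesis .
qed

lemma abs_summable_mult_bounded:
  fixes a f :: "'a \<Rightarrow> complex"
  assumes a: "(\<lambda>i. cmod (a i)) summable_on A" and "\<And>i. i \<in> A \<Longrightarrow> cmod (f i) \<le> c"
  shows "(\<lambda>i. cmod (a i * f i)) summable_on A"
    and "cmod (\<Sum>\<^sub>\<infinity>i\<in>A. a i * f i) \<le> (\<Sum>\<^sub>\<infinity>i\<in>A. cmod (a i)) * c"
proof -
  have le: "cmod (a i * f i) \<le> cmod (a i) * c" if "i \<in> A" for i
    using assms(2)[OF that] by (simp add: norm_mult mult_left_mono)
  have ac: "(\<lambda>i. cmod (a i) * c) summable_on A"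
    by (rule summable_on_cmult_left[OF a])
  show s: "(\<lambda>i. cmod (a i * f i)) summable_on A"
    by (rule Infinite_Sum.abs_summable_on_comparison_test'[OF ac le])
  have "cmod (\<Sum>\<^sub>\<infinity>i\<in>A. a i * f i) \<le> (\<Sum>\<^sub>\<infinity>i\<in>A. cmod (a i) * c)"
    using norm_infsum_bound[OF s] infsum_mono[OF s ac le] by linarith
  then show "cmod (\<Sum>\<^sub>\<infinity>i\<in>A. a i * f i) \<le> (\<Sum>\<^sub>\<infinity>i\<in>A. cmod (a i)) * c"
    by (simp add: infsum_cmult_left')
qed

section \<open>Clopen neighbourhoods in a countable compact Hausdorff space\<close>

locale countable_compact_Hausdorff_space =
  fixes T :: "'a topology"
  assumes compact: "compact_space T"
    and Hausdorff: "Hausdorff_space T"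
    and countable: "countable (topspace T)"
    and nonempty: "topspace T \<noteq> {}"
begin

definition clopen :: "'a set \<Rightarrow> bool" where
  "clopen U \<longleftrightarrow> openin T U \<and> closedin T U"

lemma clopen_topspace: "clopen (topspace T)"
  by (simp add: clopen_def)

lemma clopen_Diff: "clopen U \<Longrightarrow> clopen V \<Longrightarrow> clopen (U - V)"
  by (simp add: clopen_def openin_diff closedin_diff)

lemma clopen_INT: "finite I \<Longrightarrow> I \<noteq> {} \<Longrightarrow> (\<And>i. i \<in> I \<Longrightarrow> clopen (U i)) \<Longrightarrow> clopen (\<Inter>i\<in>I. U i)"
  unfolding clopen_def by (auto intro!: openin_INT2 closedin_Inter)

lemma clopen_subset: "clopen U \<Longrightarrow> U \<subseteq> topspace T"
  by (simp add: clopen_def openin_subset)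

text \<open>
  The image of a countable space under a Urysohn function is countable, so some level strictly
  between 0 and 1 is not attained; the sublevel set at that level is clopen.
\<close>

lemma clopen_separation:
  assumes "i \<in> topspace T" "j \<in> topspace T" "i \<noteq> j"
  obtains U where "clopen U" "i \<in> U" "j \<notin> U"
proof -
  have "normal_space T"
    using compact Hausdorff compact_Hausdorff_or_regular_imp_normal_space by blast
  moreover have "closedin T {i}" "closedin T {j}"
    using assms Hausdorff by (auto simp: closedin_Hausdorff_singleton)
  ultimately obtain f where f: "continuous_map T euclideanreal f" and "f ` {i} \<subseteq> {0}" "f ` {j} \<subseteq> {1}"
    using assms Urysohn_lemma_alt[of T "{i}" "{j}" 0 1] by (auto simp: disjnt_def)
  then have fi: "f i = 0" and fj: "f j = 1" by auto
  have "countable (f ` topspace T)" using countable by simp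
  moreover have "uncountable {0<..<1::real}" by (simp add: uncountable_open_interval)
  ultimately obtain r where r: "0 < r" "r < 1" "r \<notin> f ` topspace T"
    by (metis countable_subset greaterThanLessThan_iff subsetI)
  let ?U = "{x \<in> topspace T. f x \<in> {..<r}}"
  have "openin T ?U" using openin_continuous_map_preimage[OF f, of "{..<r}"] by simp
  moreover have "?U = {x \<in> topspace T. f x \<in> {..r}}"
    using r(3) by (auto simp: less_le)
  then have "closedin T ?U" using closedin_continuous_map_preimage[OF f, of "{..r}"] by simp
  ultimately show thesis using that[of ?U] assms fi fj r by (auto simp: clopen_def)
qed

definition clopen_base :: "'a \<Rightarrow> (nat \<Rightarrow> 'a set) \<Rightarrow> bool" where
  "clopen_base i W \<longleftrightarrow> decseq W \<and> (\<forall>n. clopen (W n) \<and> i \<in> W n) \<and>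
     (\<forall>U. openin T U \<and> i \<in> U \<longrightarrow> (\<exists>n. W n \<subseteq> U))"

text \<open>
  Separating \<open>i\<close> from the \<open>k\<close>-th point for all \<open>k \<le> n\<close> gives a decreasing sequence of clopen sets whose
  intersection is \<open>{i}\<close>. Compactness upgrades this to a neighbourhood base: the closed sets \<open>W n - U\<close>
  decrease to the empty set, so one of them is empty.
\<close>

lemma clopen_base_exists:
  assumes i: "i \<in> topspace T"
  shows "\<exists>W. clopen_base i W"
proof -
  have "\<exists>U. clopen U \<and> i \<in> U \<and> (j \<noteq> i \<longrightarrow> j \<notin> U)" if "j \<in> topspace T" for j
    using clopen_separation[OF i that] clopen_topspace i by metis
  then obtain S where S: "\<And>j. j \<in> topspace T \<Longrightarrow> clopen (S j) \<and> i \<in> S j \<and> (j \<noteq> i \<longrightarrow> j \<notin> S j)"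
    by metis
  let ?e = "from_nat_into (topspace T)"
  have e: "?e k \<in> topspace T" for k
    using nonempty by (simp add: from_nat_into)
  define W where "W n = (\<Inter>k\<in>{..n}. S (?e k))" for n
  have W: "clopen (W n)" "i \<in> W n" for n
    using S e by (auto simp: W_def intro!: clopen_INT)
  have dec: "decseq W"
    unfolding W_def decseq_def by (intro allI impI INF_superset_mono) auto
  have "\<exists>n. W n \<subseteq> U" if U: "openin T U" "i \<in> U" for U
  proof (rule ccontr)
    assume "\<not> ?thesis"
    then have "W n - U \<noteq> {}" for n by blast
    moreover have "closedin T (W n - U)" for n
      using W(1) U(1) by (auto simp: clopen_def intro!: closedin_diff)
    moreover have "decseq (\<lambda>n. W n - U)"
      using dec unfolding decseq_def by blast
    ultimately have "(\<Inter>n. W n - U) \<noteq> {}"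
      using compact_space_imp_nest[OF compact, of "\<lambda>n. W n - U"] by blast
    then obtain j where j: "\<And>n. j \<in> W n" "j \<notin> U" by blast
    then have "j \<in> topspace T" using W(1)[of 0] clopen_subset by blast
    then obtain k where "?e k = j" using from_nat_into_surj[OF countable] by blast
    moreover have "j \<noteq> i" using j U by blast
    ultimately show False
      using j(1)[of k] S[OF \<open>j \<in> topspace T\<close>] by (auto simp: W_def)
  qed
  then show ?thesis using W dec by (auto simp: clopen_base_def)
qed

definition nbhd :: "'a \<Rightarrow> nat \<Rightarrow> 'a set" where
  "nbhd i = (SOME W. clopen_base i W)"

lemma clopen_base_nbhd: "i \<in> topspace T \<Longrightarrow> clopen_base i (nbhd i)"
  unfolding nbhd_def by (rule someI_ex[OF clopen_base_exists])

lemma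
  assumes "i \<in> topspace T"
  shows decseq_nbhd: "decseq (nbhd i)"
    and clopen_nbhd: "clopen (nbhd i n)"
    and mem_nbhd: "i \<in> nbhd i n"
  using clopen_base_nbhd[OF assms] by (auto simp: clopen_base_def)

lemma eventually_nbhd_subset:
  assumes "i \<in> topspace T" "openin T U" "i \<in> U"
  shows "eventually (\<lambda>n. nbhd i n \<subseteq> U) sequentially"
proof -
  obtain N where "nbhd i N \<subseteq> U"
    using clopen_base_nbhd[OF assms(1)] assms by (auto simp: clopen_base_def)
  then have "nbhd i n \<subseteq> U" if "N \<le> n" for n
    using decseqD[OF decseq_nbhd[OF assms(1)] that] by blast
  then show ?thesis unfolding eventually_sequentially by blast
qed

lemma eventually_nbhds_disjoint:
  assumes F: "finite F" "F \<subseteq> topspace T"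
  shows "eventually (\<lambda>n. disjoint_family_on (\<lambda>i. nbhd i n) F) sequentially"
proof -
  have "eventually (\<lambda>n. nbhd i n \<inter> nbhd j n = {}) sequentially"
    if ij: "i \<in> F" "j \<in> F" "i \<noteq> j" for i j
  proof -
    obtain U V where UV: "openin T U" "openin T V" "i \<in> U" "j \<in> V" "disjnt U V"
      using Hausdorff ij F(2) unfolding Hausdorff_space_def by (meson subsetD)
    have i: "i \<in> topspace T" and j: "j \<in> topspace T" using ij F(2) by auto
    show ?thesis
      using eventually_nbhd_subset[OF i UV(1,3)] eventually_nbhd_subset[OF j UV(2,4)]
      by eventually_elim (use UV(5) in \<open>auto simp: disjnt_def\<close>)
  qed
  then have "eventually (\<lambda>n. \<forall>i\<in>F. \<forall>j\<in>F. i \<noteq> j \<longrightarrow> nbhd i n \<inter> nbhd j n = {}) sequentially"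
    using F(1) by (auto intro!: eventually_ball_finite)
  then show ?thesis by (simp add: disjoint_family_on_def)
qed

section \<open>Continuous functions and bounded functionals\<close>

abbreviation C :: "('a \<Rightarrow> complex) set" where
  "C \<equiv> vcarrier (continuous_functions T)"

abbreviation dual :: "(('a \<Rightarrow> complex) \<Rightarrow> complex) set" where
  "dual \<equiv> vcarrier (dual_space (continuous_functions T))"

lemma C_iff: "f \<in> C \<longleftrightarrow> continuous_map T euclidean f \<and> (\<forall>i. i \<notin> topspace T \<longrightarrow> f i = 0)"
  by (simp add: continuous_functions_def)

lemma C_zero: "(\<lambda>_. 0) \<in> C"
  by (simp add: C_iff)

lemma C_add: "f \<in> C \<Longrightarrow> g \<in> C \<Longrightarrow> (\<lambda>x. f x + g x) \<in> C"
  by (auto simp: C_iff intro: continuous_map_add)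

lemma C_scale: "f \<in> C \<Longrightarrow> (\<lambda>x. c * f x) \<in> C"
proof -
  assume f: "f \<in> C"
  have "continuous_map euclidean euclidean (\<lambda>z::complex. c * z)"
    by (simp add: continuous_intros)
  then have "continuous_map T euclidean ((\<lambda>z. c * z) \<circ> f)"
    using f continuous_map_compose unfolding C_iff by blast
  then show ?thesis using f by (simp add: C_iff o_def)
qed

text \<open>
  Multiplication by the indicator of a clopen set, which keeps continuity; it takes the place of
  integrating over a subset.
\<close>

definition cut :: "'a set \<Rightarrow> ('a \<Rightarrow> complex) \<Rightarrow> 'a \<Rightarrow> complex" where
  "cut U f = (\<lambda>x. if x \<in> U then f x else 0)"

lemma continuous_cut:
  assumes f: "continuous_map T euclidean f" and U: "clopen U"
  shows "cut U f \<in> C"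
proof -
  have "openin T {x \<in> topspace T. cut U f x \<in> V}" if V: "open V" for V
  proof -
    have "openin T {x \<in> topspace T. f x \<in> V}"
      using openin_continuous_map_preimage[OF f] V by simp
    then have "openin T (U \<inter> {x \<in> topspace T. f x \<in> V})" 
      using U by (auto simp: clopen_def)
    moreover have "openin T (if 0 \<in> V then topspace T - U else {})"
      using U by (auto simp: clopen_def)
    moreover have "{x \<in> topspace T. cut U f x \<in> V} =
        (U \<inter> {x \<in> topspace T. f x \<in> V}) \<union> (if 0 \<in> V then topspace T - U else {})"
      by (auto simp: cut_def)
    ultimately show ?thesis by auto
  qed
  then show ?thesis
    using clopen_subset[OF U] by (auto simp: C_iff continuous_map_def cut_def)
qed

lemma C_cut: "f \<in> C \<Longrightarrow> clopen U \<Longrightarrow> cut U f \<in> C"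
  by (simp add: C_iff[of f] continuous_cut)

lemma C_indicator: "clopen U \<Longrightarrow> indicator U \<in> C"
proof -
  assume U: "clopen U"
  have "indicator U = cut U (\<lambda>_. 1)" by (simp add: cut_def indicator_def fun_eq_iff)
  then show ?thesis using continuous_cut[of "\<lambda>_. 1" U] U by simp
qed

lemma bdd_above_C:
  assumes f: "f \<in> C"
  shows "bdd_above ((\<lambda>i. cmod (f i)) ` topspace T)"
proof -
  have "compactin euclidean (f ` topspace T)"
    using image_compactin[of T "topspace T" euclidean f] compact f
    by (simp add: compact_space_def C_iff)
  then have "bounded (f ` topspace T)" by (simp add: compact_imp_bounded)
  then show ?thesis by (auto simp: bounded_iff bdd_above_def)
qed

lemma norm_C: "vnorm (continuous_functions T) f = (SUP i\<in>topspace T. cmod (f i))"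
  by (simp add: continuous_functions_def)

lemma cmod_le_norm_C: "f \<in> C \<Longrightarrow> i \<in> topspace T \<Longrightarrow> cmod (f i) \<le> vnorm (continuous_functions T) f"
  unfolding norm_C by (rule cSUP_upper[OF _ bdd_above_C])

lemma norm_C_nonneg: "f \<in> C \<Longrightarrow> 0 \<le> vnorm (continuous_functions T) f"
  using nonempty cmod_le_norm_C by (meson all_not_in_conv norm_ge_zero order_trans)

lemma norm_C_le_iff:
  assumes "f \<in> C" "0 \<le> c"
  shows "vnorm (continuous_functions T) f \<le> c \<longleftrightarrow> (\<forall>x. cmod (f x) \<le> c)"
proof
  assume "vnorm (continuous_functions T) f \<le> c"
  then show "\<forall>x. cmod (f x) \<le> c"
    using assms cmod_le_norm_C[OF assms(1)] by (metis C_iff norm_zero order_trans)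
qed (auto simp: norm_C intro: cSUP_least[OF nonempty])

lemma dual_iff:
  "\<phi> \<in> dual \<longleftrightarrow>
     (\<forall>f\<in>C. \<forall>g\<in>C. \<phi> (\<lambda>x. f x + g x) = \<phi> f + \<phi> g) \<and>
     (\<forall>c. \<forall>f\<in>C. \<phi> (\<lambda>x. c * f x) = c * \<phi> f) \<and>
     (\<exists>K. \<forall>f\<in>C. cmod (\<phi> f) \<le> K * vnorm (continuous_functions T) f) \<and>
     (\<forall>f. f \<notin> C \<longrightarrow> \<phi> f = 0)"
proof -
  have "vadd (continuous_functions T) f g = (\<lambda>x. f x + g x)"
    "vscale (continuous_functions T) c f = (\<lambda>x. c * f x)" for f g c
    by (simp_all add: continuous_functions_def)
  then show ?thesis
    unfolding dual_space_def linear_between_def scalar_field_def by auto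
qed

lemma
  assumes "\<phi> \<in> dual" "f \<in> C"
  shows dual_add: "g \<in> C \<Longrightarrow> \<phi> (\<lambda>x. f x + g x) = \<phi> f + \<phi> g"
    and dual_scale: "\<phi> (\<lambda>x. c * f x) = c * \<phi> f"
  using assms unfolding dual_iff by auto

lemma dual_diff:
  assumes "\<phi> \<in> dual" "f \<in> C" "g \<in> C"
  shows "\<phi> (\<lambda>x. f x - g x) = \<phi> f - \<phi> g"
  using dual_add[OF assms(1,2) C_scale[OF assms(3), of "-1"]] dual_scale[OF assms(1,3), of "-1"]
  by simp

lemma dual_closed_add:
  assumes "\<phi> \<in> dual" "\<psi> \<in> dual"
  shows "(\<lambda>f. \<phi> f + \<psi> f) \<in> dual"
proof -
  obtain K where K: "\<And>f. f \<in> C \<Longrightarrow> cmod (\<phi> f) \<le> K * vnorm (continuous_functions T) f"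
    using assms(1) unfolding dual_iff by blast
  obtain L where L: "\<And>f. f \<in> C \<Longrightarrow> cmod (\<psi> f) \<le> L * vnorm (continuous_functions T) f"
    using assms(2) unfolding dual_iff by blast
  have "cmod (\<phi> f + \<psi> f) \<le> (K + L) * vnorm (continuous_functions T) f" if "f \<in> C" for f
    using K[OF that] L[OF that] norm_triangle_ineq[of "\<phi> f" "\<psi> f"] by (simp add: distrib_right)
  then have "\<exists>M. \<forall>f\<in>C. cmod (\<phi> f + \<psi> f) \<le> M * vnorm (continuous_functions T) f" by blast
  then show ?thesis
    using assms unfolding dual_iff by (simp add: distrib_left)
qed

lemma dual_closed_scale:
  assumes "\<phi> \<in> dual"
  shows "(\<lambda>f. c * \<phi> f) \<in> dual"
proof -
  obtain K where K: "\<And>f. f \<in> C \<Longrightarrow> cmod (\<phi> f) \<le> K * vnorm (continuous_functions T) f"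
    using assms unfolding dual_iff by blast
  have "cmod (c * \<phi> f) \<le> (cmod c * K) * vnorm (continuous_functions T) f" if "f \<in> C" for f
    using mult_left_mono[OF K[OF that], of "cmod c"] by (simp add: norm_mult mult.assoc)
  then have "\<exists>M. \<forall>f\<in>C. cmod (c * \<phi> f) \<le> M * vnorm (continuous_functions T) f" by blast
  then show ?thesis
    using assms unfolding dual_iff by (simp add: distrib_left mult.left_commute)
qed

section \<open>The variation of a functional\<close>

definition unit_functions :: "'a set \<Rightarrow> ('a \<Rightarrow> complex) set" where
  "unit_functions U = {f \<in> C. (\<forall>x. cmod (f x) \<le> 1) \<and> (\<forall>x. x \<notin> U \<longrightarrow> f x = 0)}"

text \<open>
  On clopen sets this is the total variation of the measure that represents the functional, defined
  without that measure.
\<close>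

definition variation :: "(('a \<Rightarrow> complex) \<Rightarrow> complex) \<Rightarrow> 'a set \<Rightarrow> real" where
  "variation \<phi> U = (SUP f\<in>unit_functions U. cmod (\<phi> f))"

lemma zero_unit_functions: "(\<lambda>_. 0) \<in> unit_functions U"
  by (simp add: unit_functions_def C_zero)

lemma norm_dual: "vnorm (dual_space (continuous_functions T)) \<phi> = variation \<phi> (topspace T)"
proof -
  have "{f \<in> C. vnorm (continuous_functions T) f \<le> 1} = unit_functions (topspace T)"
    unfolding unit_functions_def using norm_C_le_iff[of _ 1] by (auto simp: C_iff)
  then show ?thesis by (simp add: dual_space_def variation_def)
qed

lemma bdd_above_variation:
  assumes "\<phi> \<in> dual"
  shows "bdd_above ((\<lambda>f. cmod (\<phi> f)) ` unit_functions U)"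
proof -
  obtain K where K: "\<And>f. f \<in> C \<Longrightarrow> cmod (\<phi> f) \<le> K * vnorm (continuous_functions T) f"
    using assms unfolding dual_iff by blast
  have "cmod (\<phi> f) \<le> \<bar>K\<bar>" if f: "f \<in> unit_functions U" for f
  proof -
    have fC: "f \<in> C" and "vnorm (continuous_functions T) f \<le> 1"
      using f norm_C_le_iff[of f 1] by (auto simp: unit_functions_def)
    moreover have "K * vnorm (continuous_functions T) f \<le> \<bar>K\<bar> * vnorm (continuous_functions T) f"
      by (rule mult_right_mono[OF _ norm_C_nonneg[OF fC]]) simp
    ultimately show ?thesis
      using K[OF fC] mult_left_mono[of "vnorm (continuous_functions T) f" 1 "\<bar>K\<bar>"] by simp
  qed
  then show ?thesis by (auto simp: bdd_above_def)
qed

lemma cmod_le_variation: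
  "\<phi> \<in> dual \<Longrightarrow> f \<in> unit_functions U \<Longrightarrow> cmod (\<phi> f) \<le> variation \<phi> U"
  unfolding variation_def by (rule cSUP_upper[OF _ bdd_above_variation])

lemma variation_le:
  "(\<And>f. f \<in> unit_functions U \<Longrightarrow> cmod (\<phi> f) \<le> c) \<Longrightarrow> variation \<phi> U \<le> c"
  unfolding variation_def using zero_unit_functions by (intro cSUP_least) auto

lemma variation_nonneg: "\<phi> \<in> dual \<Longrightarrow> 0 \<le> variation \<phi> U"
  using cmod_le_variation[OF _ zero_unit_functions] norm_ge_zero order_trans by blast

lemma variation_mono: "\<phi> \<in> dual \<Longrightarrow> U \<subseteq> V \<Longrightarrow> variation \<phi> U \<le> variation \<phi> V"
  by (rule variation_le, rule cmod_le_variation) (auto simp: unit_functions_def)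

lemma cmod_le_mult_variation:
  assumes "\<phi> \<in> dual" "f \<in> C" "0 < c" "\<And>x. cmod (f x) \<le> c" "\<And>x. x \<notin> U \<Longrightarrow> f x = 0"
  shows "cmod (\<phi> f) \<le> c * variation \<phi> U"
proof -
  let ?g = "\<lambda>x. (1 / of_real c) * f x"
  have "?g \<in> unit_functions U"
    using assms C_scale[OF assms(2), of "1 / of_real c"] by (auto simp: unit_functions_def norm_divide)
  then have "cmod (\<phi> ?g) \<le> variation \<phi> U"
    by (rule cmod_le_variation[OF assms(1)])
  then show ?thesis
    using \<open>0 < c\<close> unfolding dual_scale[OF assms(1,2)] by (simp add: norm_divide field_simps)
qed

text \<open>
  Unimodular factors make \<open>\<phi> f\<close> and \<open>\<phi> g\<close> nonnegative, so that no cancellation occurs in their sum; since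
  \<open>f\<close> and \<open>g\<close> live on disjoint sets, the combined function still has norm at most 1.
\<close>

lemma variation_superadditive:
  assumes \<phi>: "\<phi> \<in> dual" and "U \<inter> V = {}"
  shows "variation \<phi> U + variation \<phi> V \<le> variation \<phi> (U \<union> V)"
proof -
  have *: "cmod (\<phi> f) + cmod (\<phi> g) \<le> variation \<phi> (U \<union> V)"
    if f: "f \<in> unit_functions U" and g: "g \<in> unit_functions V" for f g
  proof -
    let ?c = "cnj (sgn (\<phi> f))" and ?d = "cnj (sgn (\<phi> g))"
    let ?h = "\<lambda>x. ?c * f x + ?d * g x"
    have fC: "f \<in> C" and gC: "g \<in> C" using f g by (auto simp: unit_functions_def)
    have unit: "cnj (sgn z) * z = of_real (cmod z)" for z
      by (simp add: sgn_eq complex_norm_square[symmetric] power2_eq_square mult.commute)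
    have le: "cmod (cnj (sgn z) * w) \<le> cmod w" for z w
      by (simp add: norm_mult norm_sgn)
    have "cmod (?h x) \<le> 1" for x
    proof -
      have "f x = 0 \<or> g x = 0" using f g assms(2) by (auto simp: unit_functions_def)
      then show ?thesis
      proof
        assume "f x = 0"
        moreover have "cmod (g x) \<le> 1" using g by (simp add: unit_functions_def)
        ultimately show ?thesis using le[of "\<phi> g" "g x"] by simp
      next
        assume "g x = 0"
        moreover have "cmod (f x) \<le> 1" using f by (simp add: unit_functions_def)
        ultimately show ?thesis using le[of "\<phi> f" "f x"] by simp
      qed
    qed
    moreover have "?h \<in> C" by (intro C_add C_scale fC gC)
    ultimately have "?h \<in> unit_functions (U \<union> V)"
      using f g by (auto simp: unit_functions_def)
    then have "cmod (\<phi> ?h) \<le> variation \<phi> (U \<union> V)" by (rule cmod_le_variation[OF \<phi>])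
    moreover have "\<phi> ?h = ?c * \<phi> f + ?d * \<phi> g"
      using dual_add[OF \<phi> C_scale[OF fC] C_scale[OF gC]] dual_scale[OF \<phi> fC] dual_scale[OF \<phi> gC]
      by simp
    then have "\<phi> ?h = of_real (cmod (\<phi> f) + cmod (\<phi> g))" unfolding unit by simp
    then have "cmod (\<phi> ?h) = cmod (\<phi> f) + cmod (\<phi> g)"
      by (metis abs_of_nonneg add_nonneg_nonneg norm_ge_zero norm_of_real)
    ultimately show ?thesis by simp
  qed
  have "variation \<phi> U \<le> variation \<phi> (U \<union> V) - cmod (\<phi> g)" if "g \<in> unit_functions V" for g
    by (rule variation_le) (use *[OF _ that] in force)
  then have "variation \<phi> V \<le> variation \<phi> (U \<union> V) - variation \<phi> U"
    by (intro variation_le) force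
  then show ?thesis by simp
qed

lemma sum_variation_le:
  assumes \<phi>: "\<phi> \<in> dual" and "finite F" and "disjoint_family_on U F"
  shows "(\<Sum>i\<in>F. variation \<phi> (U i)) \<le> variation \<phi> (\<Union>i\<in>F. U i)"
  using assms(2,3)
proof (induction F)
  case empty
  then show ?case using variation_nonneg[OF \<phi>] by simp
next
  case (insert j F)
  then have "disjoint_family_on U F" "U j \<inter> (\<Union>i\<in>F. U i) = {}"
    by (auto simp: disjoint_family_on_def)
  then show ?case
    using insert variation_superadditive[OF \<phi>, of "U j" "\<Union>i\<in>F. U i"] by simp
qed

lemma cut_decomposition: 
  assumes \<phi>: "\<phi> \<in> dual" and f: "f \<in> C" and U: "clopen U"
  shows "\<phi> f = \<phi> (cut U f) + \<phi> (cut (topspace T - U) f)"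
proof -
  have "f = (\<lambda>x. cut U f x + cut (topspace T - U) f x)"
    using f by (auto simp: cut_def C_iff)
  moreover have "\<phi> (\<lambda>x. cut U f x + cut (topspace T - U) f x) =
      \<phi> (cut U f) + \<phi> (cut (topspace T - U) f)"
    by (intro dual_add[OF \<phi>] C_cut f U clopen_Diff clopen_topspace)
  ultimately show ?thesis by simp
qed

text \<open>
  A unit function on \<open>U \<union> V\<close> is split into its part on \<open>U\<close> and its part off \<open>U\<close>. Both parts are
  continuous because \<open>U\<close> is clopen.
\<close>

lemma variation_subadditive:
  assumes \<phi>: "\<phi> \<in> dual" and U: "clopen U"
  shows "variation \<phi> (U \<union> V) \<le> variation \<phi> U + variation \<phi> V"
proof (rule variation_le)
  fix f assume f: "f \<in> unit_functions (U \<union> V)"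
  then have fC: "f \<in> C" by (simp add: unit_functions_def)
  have "cut U f \<in> unit_functions U" "cut (topspace T - U) f \<in> unit_functions V"
    using f C_cut[OF fC U] C_cut[OF fC clopen_Diff[OF clopen_topspace U]]
    by (auto simp: unit_functions_def cut_def)
  then have "cmod (\<phi> (cut U f)) + cmod (\<phi> (cut (topspace T - U) f)) \<le> variation \<phi> U + variation \<phi> V"
    by (intro add_mono cmod_le_variation[OF \<phi>])
  then show "cmod (\<phi> f) \<le> variation \<phi> U + variation \<phi> V"
    using cut_decomposition[OF \<phi> fC U] norm_triangle_le by metis
qed

lemma variation_le_sum:
  assumes \<phi>: "\<phi> \<in> dual" and "finite F" and "\<And>i. i \<in> F \<Longrightarrow> clopen (U i)"
  shows "variation \<phi> (\<Union>i\<in>F. U i) \<le> (\<Sum>i\<in>F. variation \<phi> (U i))"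
  using assms(2,3)
proof (induction F)
  case empty
  have "\<phi> (\<lambda>_. 0) = 0" using dual_scale[OF \<phi> C_zero, of 0] by simp
  then have "cmod (\<phi> f) \<le> 0" if "f \<in> unit_functions {}" for f
  proof -
    have "f = (\<lambda>_. 0)" using that by (auto simp: unit_functions_def)
    then show ?thesis using \<open>\<phi> (\<lambda>_. 0) = 0\<close> by simp
  qed
  then show ?case by (simp add: variation_le)
next
  case (insert j F)
  then show ?case
    using variation_subadditive[OF \<phi>, of "U j" "\<Union>i\<in>F. U i"] by force
qed

section \<open>Atoms\<close>

definition atom :: "(('a \<Rightarrow> complex) \<Rightarrow> complex) \<Rightarrow> 'a \<Rightarrow> complex" where
  "atom \<phi> i = (if i \<in> topspace T then lim (\<lambda>n. \<phi> (indicator (nbhd i n))) else 0)"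

lemma cmod_indicator_le_variation:
  assumes "\<phi> \<in> dual" "clopen U"
  shows "cmod (\<phi> (indicator U)) \<le> variation \<phi> U"
  using assms by (intro cmod_le_variation) (auto simp: unit_functions_def C_indicator split: split_indicator)

lemma variation_nbhd_Diff:
  assumes \<phi>: "\<phi> \<in> dual" and i: "i \<in> topspace T" and "n \<le> m"
  shows "variation \<phi> (nbhd i n - nbhd i m) \<le> variation \<phi> (nbhd i n) - variation \<phi> (nbhd i m)"
proof -
  have "nbhd i m \<subseteq> nbhd i n" using decseqD[OF decseq_nbhd[OF i] \<open>n \<le> m\<close>] .
  then show ?thesis
    using variation_superadditive[OF \<phi>, of "nbhd i n - nbhd i m" "nbhd i m"]
    by (simp add: Un_absorb2  Int_commute)
qed

lemma convergent_variation_nbhd: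
  assumes \<phi>: "\<phi> \<in> dual" and i: "i \<in> topspace T"
  shows "convergent (\<lambda>n. variation \<phi> (nbhd i n))"
proof -
  have "decseq (\<lambda>n. variation \<phi> (nbhd i n))"
    using decseq_nbhd[OF i] variation_mono[OF \<phi>] by (simp add: decseq_def)
  then obtain L where "(\<lambda>n. variation \<phi> (nbhd i n)) \<longlonglongrightarrow> L"
    using decseq_convergent variation_nonneg[OF \<phi>] by metis
  then show ?thesis by (auto simp: convergent_def)
qed

text \<open>
  Two indicators in the sequence differ by the indicator of a difference of neighbourhoods, where
  superadditivity bounds the functional by the decrease of the variation. Thus the values inherit the
  Cauchy property from the monotone bounded sequence of variations.
\<close>

lemma atom_tendsto:
  assumes \<phi>: "\<phi> \<in> dual" and i: "i \<in> topspace T"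
  shows "(\<lambda>n. \<phi> (indicator (nbhd i n))) \<longlonglongrightarrow> atom \<phi> i"
proof -
  let ?v = "\<lambda>n. variation \<phi> (nbhd i n)" and ?a = "\<lambda>n. \<phi> (indicator (nbhd i n))"
  have diff: "dist (?a n) (?a m) \<le> dist (?v n) (?v m)" if "n \<le> m" for n m
  proof -
    have sub: "nbhd i m \<subseteq> nbhd i n" using decseqD[OF decseq_nbhd[OF i] that] .
    have "(\<lambda>x. indicator (nbhd i n) x - indicator (nbhd i m) x :: complex) =
        indicator (nbhd i n - nbhd i m)"
      using sub by (auto simp: fun_eq_iff split: split_indicator)
    then have "?a n - ?a m = \<phi> (indicator (nbhd i n - nbhd i m))"
      using dual_diff[OF \<phi>] C_indicator clopen_nbhd[OF i] by metis
    moreover have "cmod (\<phi> (indicator (nbhd i n - nbhd i m))) \<le> variation \<phi> (nbhd i n - nbhd i m)"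
      by (intro cmod_indicator_le_variation \<phi> clopen_Diff clopen_nbhd i)
    ultimately show ?thesis
      using variation_nbhd_Diff[OF \<phi> i that] by (simp add: dist_norm)
  qed
  have diff': "dist (?a n) (?a m) \<le> dist (?v n) (?v m)" for n m
    using diff[of n m] diff[of m n] by (metis dist_commute nle_le)
  have "Cauchy ?v" using convergent_variation_nbhd[OF \<phi> i] convergent_Cauchy by blast
  then have "Cauchy ?a"
    unfolding Cauchy_def using diff' by (meson le_less_trans)
  then show ?thesis
    using i by (simp add: atom_def Cauchy_convergent convergent_LIMSEQ_iff[symmetric])
qed

lemma atom_eqI:
  assumes "i \<in> topspace T" "(\<lambda>n. \<phi> (indicator (nbhd i n))) \<longlonglongrightarrow> a"
  shows "atom \<phi> i = a"
  using assms by (simp add: atom_def limI)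

lemma atom_add:
  assumes "\<phi> \<in> dual" "\<psi> \<in> dual"
  shows "atom (\<lambda>f. \<phi> f + \<psi> f) i = atom \<phi> i + atom \<psi> i"
proof (cases "i \<in> topspace T")
  case True
  then show ?thesis using assms by (intro atom_eqI tendsto_add atom_tendsto)
qed (simp add: atom_def)

lemma atom_scale:
  assumes "\<phi> \<in> dual"
  shows "atom (\<lambda>f. c * \<phi> f) i = c * atom \<phi> i"
proof (cases "i \<in> topspace T")
  case True
  then show ?thesis using assms by (intro atom_eqI tendsto_mult_left atom_tendsto)
qed (simp add: atom_def)

text \<open>
  Neighbourhoods of finitely many points are eventually disjoint, and their variations then add up to
  at most the variation of the whole space.
\<close>

lemma sum_atoms_le_variation:
  assumes \<phi>: "\<phi> \<in> dual" and F: "finite F" "F \<subseteq> topspace T"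
  shows "(\<Sum>i\<in>F. cmod (atom \<phi> i)) \<le> variation \<phi> (topspace T)"
proof (rule tendsto_upperbound)
  show "(\<lambda>n. \<Sum>i\<in>F. cmod (\<phi> (indicator (nbhd i n)))) \<longlonglongrightarrow> (\<Sum>i\<in>F. cmod (atom \<phi> i))"
    using F by (intro tendsto_sum tendsto_norm atom_tendsto[OF \<phi>]) auto
  show "eventually (\<lambda>n. (\<Sum>i\<in>F. cmod (\<phi> (indicator (nbhd i n)))) \<le> variation \<phi> (topspace T)) sequentially"
    using eventually_nbhds_disjoint[OF F]
  proof eventually_elim
    case (elim n)
    have clo: "clopen (nbhd i n)" if "i \<in> F" for i using that F clopen_nbhd by blast
    have "(\<Sum>i\<in>F. cmod (\<phi> (indicator (nbhd i n)))) \<le> (\<Sum>i\<in>F. variation \<phi> (nbhd i n))"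
      by (intro sum_mono cmod_indicator_le_variation[OF \<phi>] clo)
    also have "\<dots> \<le> variation \<phi> (\<Union>i\<in>F. nbhd i n)"
      by (rule sum_variation_le[OF \<phi> F(1) elim])
    also have "\<dots> \<le> variation \<phi> (topspace T)"
      using clo clopen_subset by (intro variation_mono[OF \<phi>]) blast
    finally show ?case .
  qed
qed simp

lemma summable_atoms:
  assumes \<phi>: "\<phi> \<in> dual"
  shows "(\<lambda>i. cmod (atom \<phi> i)) summable_on topspace T"
  using sum_atoms_le_variation[OF \<phi>]
  by (intro nonneg_bdd_above_summable_on) (auto simp: bdd_above_def)

text \<open>
  By continuity \<open>f\<close> is uniformly close to the constant \<open>f i\<close> on small neighbourhoods of \<open>i\<close>, so the
  difference of the two cut functions tends to 0 in norm.
\<close>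

lemma cut_nbhd_tendsto:
  assumes \<phi>: "\<phi> \<in> dual" and f: "f \<in> C" and i: "i \<in> topspace T"
  shows "(\<lambda>m. \<phi> (cut (nbhd i m) f)) \<longlonglongrightarrow> f i * atom \<phi> i"
proof -
  let ?g = "\<lambda>m x. cut (nbhd i m) f x - f i * indicator (nbhd i m) x"
  have gC: "?g m \<in> C" for m
    using C_add[OF C_cut[OF f clopen_nbhd[OF i]] C_scale[OF C_indicator[OF clopen_nbhd[OF i]]], of m "- f i" m]
    by simp
  have \<phi>g: "\<phi> (?g m) = \<phi> (cut (nbhd i m) f) - f i * \<phi> (indicator (nbhd i m))" for m
    using dual_diff[OF \<phi> C_cut[OF f clopen_nbhd[OF i]] C_scale[OF C_indicator[OF clopen_nbhd[OF i]]]]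
      dual_scale[OF \<phi> C_indicator[OF clopen_nbhd[OF i]]] by simp
  have "(\<lambda>m. \<phi> (?g m)) \<longlonglongrightarrow> 0"
  proof (rule tendstoI)
    fix e :: real assume "0 < e"
    define V where "V = variation \<phi> (topspace T)"
    have V: "0 \<le> V" unfolding V_def by (rule variation_nonneg[OF \<phi>])
    \<comment> \<open>The summand 1 keeps the denominator positive when the functional is zero.\<close>
    define d where "d = e / (V + 1)"
    have d: "0 < d" "d * V < e" using V \<open>0 < e\<close> by (auto simp: d_def field_simps)
    let ?O = "{x \<in> topspace T. f x \<in> ball (f i) d}"
    have "openin T ?O"
      using f openin_continuous_map_preimage[of T euclidean f "ball (f i) d"] by (simp add: C_iff)
    then have "eventually (\<lambda>m. nbhd i m \<subseteq> ?O) sequentially"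
      using i d by (intro eventually_nbhd_subset) auto
    then show "eventually (\<lambda>m. dist (\<phi> (?g m)) 0 < e) sequentially"
    proof eventually_elim
      case (elim m)
      have "cmod (?g m x) \<le> d" for x
        using elim d by (force simp: cut_def indicator_def dist_norm norm_minus_commute)
      then have "cmod (\<phi> (?g m)) \<le> d * variation \<phi> (topspace T)"
        using gC d by (intro cmod_le_mult_variation[OF \<phi>]) (auto simp: C_iff)
      then show ?case using d by (simp add: V_def)
    qed
  qed
  then have "(\<lambda>m. \<phi> (?g m) + f i * \<phi> (indicator (nbhd i m))) \<longlonglongrightarrow> 0 + f i * atom \<phi> i"
    by (intro tendsto_intros atom_tendsto[OF \<phi> i])
  then show ?thesis by (simp add: \<phi>g)
qed

text \<open>
  No variation near \<open>i\<close> is left over beyond the atom. A unit function \<open>f\<close> on \<open>nbhd i n\<close> is split at a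
  smaller \<open>nbhd i m\<close>: the outer part is bounded by the loss of variation from \<open>n\<close> to \<open>m\<close>, and the inner
  part tends to \<open>f i\<close> times the atom. Letting \<open>m\<close> tend to infinity bounds \<open>variation \<phi> (nbhd i n)\<close> by
  itself minus \<open>L\<close> plus the size of the atom.
\<close>

lemma variation_nbhd_limit_le_atom:
  assumes \<phi>: "\<phi> \<in> dual" and i: "i \<in> topspace T"
    and L: "(\<lambda>n. variation \<phi> (nbhd i n)) \<longlonglongrightarrow> L"
  shows "L \<le> cmod (atom \<phi> i)"
proof -
  \<comment> \<open>A single, arbitrary \<open>n\<close> suffices, since its variation cancels at the end.\<close>
  fix n :: nat
  have "cmod (\<phi> f) \<le> variation \<phi> (nbhd i n) - L + cmod (atom \<phi> i)"
    if f: "f \<in> unit_functions (nbhd i n)" for f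
  proof -
    have fC: "f \<in> C" and fi: "cmod (f i) \<le> 1" using f by (auto simp: unit_functions_def)
    have bound: "cmod (\<phi> f) \<le> variation \<phi> (nbhd i n) - variation \<phi> (nbhd i m) + cmod (\<phi> (cut (nbhd i m) f))"
      if "n \<le> m" for m
    proof -
      have "cut (topspace T - nbhd i m) f \<in> unit_functions (nbhd i n - nbhd i m)"
        using f C_cut[OF fC clopen_Diff[OF clopen_topspace clopen_nbhd[OF i]]]
        by (auto simp: unit_functions_def cut_def)
      then have "cmod (\<phi> (cut (topspace T - nbhd i m) f)) \<le> variation \<phi> (nbhd i n) - variation \<phi> (nbhd i m)"
        using cmod_le_variation[OF \<phi>] variation_nbhd_Diff[OF \<phi> i that] order_trans by blast
      then show ?thesis
        using cut_decomposition[OF \<phi> fC clopen_nbhd[OF i, of m]]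
          norm_triangle_ineq[of "\<phi> (cut (nbhd i m) f)" "\<phi> (cut (topspace T - nbhd i m) f)"] by simp
    qed
    have "(\<lambda>m. variation \<phi> (nbhd i n) - variation \<phi> (nbhd i m) + cmod (\<phi> (cut (nbhd i m) f)))
        \<longlonglongrightarrow> variation \<phi> (nbhd i n) - L + cmod (f i * atom \<phi> i)"
      by (intro tendsto_intros L cut_nbhd_tendsto \<phi> fC i)
    then have "cmod (\<phi> f) \<le> variation \<phi> (nbhd i n) - L + cmod (f i * atom \<phi> i)"
      using bound by (intro LIMSEQ_le_const) auto
    then show ?thesis
      using mult_right_mono[OF fi, of "cmod (atom \<phi> i)"] by (simp add: norm_mult)
  qed
  then have "variation \<phi> (nbhd i n) \<le> variation \<phi> (nbhd i n) - L + cmod (atom \<phi> i)"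
    by (rule variation_le)
  then show ?thesis by simp
qed

text \<open>
  This is the step that excludes a diffuse part, by the argument that countable sets without atoms are
  null: errors weighted by distinct powers of 1/2 allow one neighbourhood per point, and compactness
  leaves only finitely many of them, so that finite subadditivity is enough.
\<close>

lemma variation_le_infsum_atoms:
  assumes \<phi>: "\<phi> \<in> dual"
  shows "variation \<phi> (topspace T) \<le> (\<Sum>\<^sub>\<infinity>i\<in>topspace T. cmod (atom \<phi> i))"
proof (rule field_le_epsilon)
  fix e :: real assume e: "0 < e"
  let ?w = "\<lambda>i. (1/2::real) ^ Suc (to_nat_on (topspace T) i)"
  have "\<exists>n. variation \<phi> (nbhd i n) < cmod (atom \<phi> i) + e * ?w i" if i: "i \<in> topspace T" for i
  proof -
    obtain L where L: "(\<lambda>n. variation \<phi> (nbhd i n)) \<longlonglongrightarrow> L"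
      using convergent_variation_nbhd[OF \<phi> i] by (auto simp: convergent_def)
    have "0 < e * ?w i" using e by simp
    then have "L < cmod (atom \<phi> i) + e * ?w i"
      using variation_nbhd_limit_le_atom[OF \<phi> i L] by linarith
    from order_tendstoD(2)[OF L this] show ?thesis
      by (auto simp: eventually_sequentially)
  qed
  then obtain n where n: "\<And>i. i \<in> topspace T \<Longrightarrow> variation \<phi> (nbhd i (n i)) < cmod (atom \<phi> i) + e * ?w i"
    by metis
  let ?U = "\<lambda>i. nbhd i (n i)"
  have "\<forall>U\<in>?U ` topspace T. openin T U" "topspace T \<subseteq> \<Union>(?U ` topspace T)"
    using clopen_nbhd mem_nbhd by (auto simp: clopen_def)
  then obtain \<F> where "finite \<F>" "\<F> \<subseteq> ?U ` topspace T" "topspace T \<subseteq> \<Union>\<F>"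
    using compact[unfolded compact_space_alt, rule_format, of "?U ` topspace T"] by blast
  then obtain F where F: "finite F" "F \<subseteq> topspace T" "topspace T \<subseteq> (\<Union>i\<in>F. ?U i)"
    using finite_subset_image[of \<F> ?U "topspace T"] by auto
  have "variation \<phi> (topspace T) \<le> variation \<phi> (\<Union>i\<in>F. ?U i)"
    by (rule variation_mono[OF \<phi> F(3)])
  also have "\<dots> \<le> (\<Sum>i\<in>F. variation \<phi> (?U i))"
    using F clopen_nbhd by (intro variation_le_sum[OF \<phi>]) auto
  also have "\<dots> \<le> (\<Sum>i\<in>F. cmod (atom \<phi> i) + e * ?w i)"
    using F n by (intro sum_mono less_imp_le) auto
  also have "\<dots> = (\<Sum>i\<in>F. cmod (atom \<phi> i)) + e * (\<Sum>i\<in>F. ?w i)"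
    by (simp add: sum.distrib sum_distrib_left)
  also have "\<dots> \<le> (\<Sum>\<^sub>\<infinity>i\<in>topspace T. cmod (atom \<phi> i)) + e * 1"
  proof (intro add_mono mult_left_mono)
    show "(\<Sum>i\<in>F. cmod (atom \<phi> i)) \<le> (\<Sum>\<^sub>\<infinity>i\<in>topspace T. cmod (atom \<phi> i))"
      using F by (intro finite_sum_le_infsum summable_atoms[OF \<phi>]) auto
    show "(\<Sum>i\<in>F. ?w i) \<le> 1"
      using F countable by (intro sum_half_powers_le) (auto intro: inj_on_subset inj_on_to_nat_on)
  qed (use e in auto)
  finally show "variation \<phi> (topspace T) \<le> (\<Sum>\<^sub>\<infinity>i\<in>topspace T. cmod (atom \<phi> i)) + e" by simp
qed

lemma infsum_atoms_eq_norm: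
  assumes \<phi>: "\<phi> \<in> dual"
  shows "(\<Sum>\<^sub>\<infinity>i\<in>topspace T. cmod (atom \<phi> i)) = vnorm (dual_space (continuous_functions T)) \<phi>"
  unfolding norm_dual
proof (rule antisym)
  show "(\<Sum>\<^sub>\<infinity>i\<in>topspace T. cmod (atom \<phi> i)) \<le> variation \<phi> (topspace T)"
    by (intro infsum_le_finite_sums summable_atoms sum_atoms_le_variation \<phi>)
qed (rule variation_le_infsum_atoms[OF \<phi>])

text \<open>Injectivity of a linear isometry: the difference has zero atoms, hence zero norm.\<close>

lemma dual_eqI:
  assumes \<phi>: "\<phi> \<in> dual" and \<psi>: "\<psi> \<in> dual" and eq: "\<And>i. atom \<phi> i = atom \<psi> i"
  shows "\<phi> = \<psi>"
proof
  fix f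
  define \<rho> where "\<rho> = (\<lambda>f. \<phi> f + (-1) * \<psi> f)"
  have \<rho>: "\<rho> \<in> dual"
    unfolding \<rho>_def by (rule dual_closed_add[OF \<phi> dual_closed_scale[OF \<psi>]])
  have "atom \<rho> i = 0" for i
    using atom_add[OF \<phi> dual_closed_scale[OF \<psi>, of "-1"], of i] atom_scale[OF \<psi>, of "-1" i] eq
    by (simp add: \<rho>_def)
  then have 0: "variation \<rho> (topspace T) \<le> 0"
    using variation_le_infsum_atoms[OF \<rho>] by simp
  show "\<phi> f = \<psi> f"
  proof (cases "f \<in> C")
    case True
    let ?c = "vnorm (continuous_functions T) f + 1"
    have c: "0 < ?c" using norm_C_nonneg[OF True] by simp
    moreover have "cmod (f x) \<le> ?c" for x
      using norm_C_le_iff[OF True, of ?c] c by simp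
    ultimately have "cmod (\<rho> f) \<le> ?c * variation \<rho> (topspace T)"
      using True by (intro cmod_le_mult_variation[OF \<rho>]) (auto simp: C_iff)
    also have "\<dots> \<le> 0" using c 0 by (simp add: mult_nonneg_nonpos)
    finally show ?thesis by (simp add: \<rho>_def)
  next
    case False
    then show ?thesis using \<phi> \<psi> unfolding dual_iff by metis
  qed
qed

section \<open>Functionals given by summable families\<close>

definition weighted_sum :: "('a \<Rightarrow> complex) \<Rightarrow> ('a \<Rightarrow> complex) \<Rightarrow> complex" where
  "weighted_sum a f = (if f \<in> C then \<Sum>\<^sub>\<infinity>i\<in>topspace T. a i * f i else 0)"

lemma weighted_sum_dual:
  assumes a: "(\<lambda>i. cmod (a i)) summable_on topspace T"
  shows "weighted_sum a \<in> dual"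
proof -
  have s: "(\<lambda>i. a i * f i) summable_on topspace T" if "f \<in> C" for f
    by (rule abs_summable_summable[OF abs_summable_mult_bounded(1)[OF a cmod_le_norm_C[OF that]]])
  have "weighted_sum a (\<lambda>x. f x + g x) = weighted_sum a f + weighted_sum a g" if "f \<in> C" "g \<in> C" for f g
    using that s C_add by (simp add: weighted_sum_def distrib_left infsum_add)
  moreover have "weighted_sum a (\<lambda>x. c * f x) = c * weighted_sum a f" if "f \<in> C" for f c
    using that C_scale by (simp add: weighted_sum_def mult.left_commute[of _ c] infsum_cmult_right')
  moreover have "cmod (weighted_sum a f) \<le>
      (\<Sum>\<^sub>\<infinity>i\<in>topspace T. cmod (a i)) * vnorm (continuous_functions T) f" if "f \<in> C" for f
    using abs_summable_mult_bounded(2)[OF a cmod_le_norm_C[OF that]] that by (simp add: weighted_sum_def)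
  moreover have "weighted_sum a f = 0" if "f \<notin> C" for f
    using that by (simp add: weighted_sum_def)
  ultimately show ?thesis unfolding dual_iff by blast
qed

text \<open>
  Outside a finite set \<open>F\<close> the coefficients sum to less than \<open>e\<close>, and small neighbourhoods of \<open>i\<close> contain no
  point of \<open>F\<close> other than \<open>i\<close>. So all that such a neighbourhood adds to \<open>a i\<close> comes from the tail.
\<close>

lemma atom_weighted_sum:
  assumes a: "(\<lambda>i. cmod (a i)) summable_on topspace T" and i: "i \<in> topspace T"
  shows "atom (weighted_sum a) i = a i"
proof (rule atom_eqI[OF i tendstoI])
  fix e :: real assume e: "0 < e"
  obtain F where F: "finite F" "F \<subseteq> topspace T"
    and "dist (\<Sum>j\<in>F. cmod (a j)) (\<Sum>\<^sub>\<infinity>j\<in>topspace T. cmod (a j)) \<le> e / 2"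
    using infsum_finite_approximation[OF a, of "e / 2"] e by auto
  moreover have "(\<Sum>\<^sub>\<infinity>j\<in>topspace T - F. cmod (a j)) =
      (\<Sum>\<^sub>\<infinity>j\<in>topspace T. cmod (a j)) - (\<Sum>j\<in>F. cmod (a j))"
    using infsum_Diff[OF a summable_on_finite[OF F(1)] F(2)] F by simp
  ultimately have tail: "(\<Sum>\<^sub>\<infinity>j\<in>topspace T - F. cmod (a j)) < e"
    using e unfolding dist_real_def by linarith
  have "closedin T (F - {i})"
    using F Hausdorff by (intro closedin_Hausdorff_finite) auto
  then have "eventually (\<lambda>n. nbhd i n \<subseteq> topspace T - (F - {i})) sequentially"
    using i by (intro eventually_nbhd_subset) auto
  then show "eventually (\<lambda>n. dist (weighted_sum a (indicator (nbhd i n))) (a i) < e) sequentially"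
  proof eventually_elim
    case (elim n)
    let ?g = "\<lambda>j. indicator (nbhd i n) j - indicator {i} j :: complex"
    have s: "(\<lambda>j. a j * indicator S j) summable_on topspace T" for S
      by (rule abs_summable_summable, rule abs_summable_mult_bounded(1)[OF a, of _ 1]) (simp add: indicator_def)
    have "(\<Sum>\<^sub>\<infinity>j\<in>topspace T. a j * indicator {i} j) = (\<Sum>\<^sub>\<infinity>j\<in>{i}. a j)"
      using i by (intro infsum_cong_neutral) auto
    then have "weighted_sum a (indicator (nbhd i n)) - a i = (\<Sum>\<^sub>\<infinity>j\<in>topspace T. a j * ?g j)"
      using infsum_add[OF s[of "nbhd i n"] summable_on_uminus[THEN iffD2, OF s[of "{i}"]]]
        C_indicator[OF clopen_nbhd[OF i]]
      by (simp add: weighted_sum_def right_diff_distrib infsum_uminus)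
    also have "\<dots> = (\<Sum>\<^sub>\<infinity>j\<in>topspace T - F. a j * ?g j)"
      using elim mem_nbhd[OF i, of n] by (intro infsum_cong_neutral) (auto simp: indicator_def)
    finally have "cmod (weighted_sum a (indicator (nbhd i n)) - a i) \<le> (\<Sum>\<^sub>\<infinity>j\<in>topspace T - F. cmod (a j)) * 1"
      using abs_summable_mult_bounded(2)[OF summable_on_subset_banach[OF a], of "topspace T - F" ?g 1]
        mem_nbhd[OF i, of n] by (auto simp: indicator_def)
    then show ?case using tail by (simp add: dist_norm)
  qed
qed

end

section \<open>The dual space as a sequence space\<close>

theorem proposition1:
  fixes T :: "nat topology"
  assumes "topspace T = {1..}"
    and "compact_space T"
    and "Hausdorff_space T"
  shows "isometrically_isomorphic (dual_space (continuous_functions T)) l1"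
proof -
  interpret countable_compact_Hausdorff_space T
    using assms by unfold_locales auto
  have carrier: "a \<in> vcarrier l1 \<longleftrightarrow> (\<lambda>i. cmod (a i)) summable_on topspace T \<and> a 0 = 0" for a
    by (simp add: l1_def assms(1))
  have lin: "linear_between (dual_space (continuous_functions T)) l1 atom"
    unfolding linear_between_def
  proof (intro conjI ballI allI)
    fix \<phi> \<psi> and c :: complex assume \<phi>: "\<phi> \<in> dual"
    show "atom \<phi> \<in> vcarrier l1"
      using summable_atoms[OF \<phi>] by (simp add: carrier atom_def assms(1))
    show "atom (vscale (dual_space (continuous_functions T)) c \<phi>) = vscale l1 c (atom \<phi>)"
      using atom_scale[OF \<phi>] by (simp add: dual_space_def l1_def fun_eq_iff)
    assume \<psi>: "\<psi> \<in> dual"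
    show "atom (vadd (dual_space (continuous_functions T)) \<phi> \<psi>) = vadd l1 (atom \<phi>) (atom \<psi>)"
      using atom_add[OF \<phi> \<psi>] by (simp add: dual_space_def l1_def fun_eq_iff)
  qed
  have "inj_on atom dual"
    by (rule inj_onI) (simp add: dual_eqI)
  moreover have "a \<in> atom ` dual" if a: "a \<in> vcarrier l1" for a
  proof
    have s: "(\<lambda>i. cmod (a i)) summable_on topspace T" and "a 0 = 0"
      using a by (simp_all add: carrier)
    show "weighted_sum a \<in> dual" by (rule weighted_sum_dual[OF s])
    show "a = atom (weighted_sum a)"
    proof
      fix i show "a i = atom (weighted_sum a) i"
        using atom_weighted_sum[OF s, of i] \<open>a 0 = 0\<close> by (cases "i = 0") (auto simp: atom_def assms(1))
    qed
  qed
  ultimately have "bij_betw atom dual (vcarrier l1)"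
    using lin by (auto simp: bij_betw_def linear_between_def)
  moreover have "vnorm l1 (atom \<phi>) = vnorm (dual_space (continuous_functions T)) \<phi>" if "\<phi> \<in> dual" for \<phi>
    using infsum_atoms_eq_norm[OF that] by (simp add: l1_def assms(1))
  ultimately show ?thesis
    using lin unfolding isometrically_isomorphic_def by blast
qed

end
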